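(* Let $\mathsf{A}\in\mathbb{R}^{J_1\times J_1\times\cdots\times J_N\times J_N}$ and suppose that a CPD $\mathsf{A}=\sum_{r=1}^R\lambda_r\,\mathbf{a}_r^{(1)}\circ\cdots\circ\mathbf{a}_r^{(2N)}$ is given such that, for at least one odd $n$ and at least one even $m$ in $\{1,\dots,2N\}$, the factor matrices $\mathbf{A}^{(n)}$ and $\mathbf{A}^{(m)}$ each have orthonormal columns. Consider the unforced multilinear time-invariant system $\mathsf{X}_{t+1}=\mathsf{A}*\mathsf{X}_t$, $\mathsf{X}_t\in\mathbb{R}^{J_1\times\cdots\times J_N}$. If the first weight satisfies $\lambda_1<1$, then the equilibrium point $\mathsf{X}=\mathsf{O}$ is asymptotically stable.
   Context: The Einstein product of $\mathsf{A}$ (entries $\mathsf{A}_{j_1i_1\cdots j_Ni_N}$) with $\mathsf{X}\in\mathbb{R}^{J_1\times\cdots\times J_N}$ is $(\mathsf{A}*\mathsf{X})_{j_1\cdots j_N}=\sum_{i_1}\cdots\sum_{i_N}\mathsf{A}_{j_1i_1\cdots j_Ni_N}\mathsf{X}_{i_1\cdots i_N}$. $\|\cdot\|$ is the Frobenius norm and $\mathsf{O}$ the zero tensor. The equilibrium $\mathsf{X}=\mathsf{O}$ is asymptotically stable if $\|\mathsf{X}_t\|\to0$ as $t\to\infty$ for every initial condition $\mathsf{X}_0$. In the CPD, $\circ$ is the outer product, all vectors $\mathbf{a}_r^{(n)}$ have unit length, the weights are in descending order $\lambda_1\ge\cdots\ge\lambda_R>0$, $R$ is the CP rank (the minimum number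 of terms in such an expression), the $n$-th vector corresponds to the $n$-th mode of $\mathsf{A}$ in the order $(j_1,i_1,\dots,j_N,i_N)$, and the factor matrices are $\mathbf{A}^{(n)}=[\mathbf{a}_1^{(n)}\ \cdots\ \mathbf{a}_R^{(n)}]$. *)

theory Defs
  imports "HOL-Analysis.L2_Norm" "HOL-Library.FuncSet" Complex_Main
begin

text \<open>Since order and dimensions of a tensor vary, an element of
  \<open>\<real>\<^bsup>d 1 \<times> \<dots> \<times> d K\<^esup>\<close> is represented as a real function on the
  multi-indices \<open>k\<close> with \<open>1 \<le> k n \<le> d n\<close>, extensional outside, so that equality
  of tensors is equality of functions.\<close>

definition indices :: "nat \<Rightarrow> (nat \<Rightarrow> nat) \<Rightarrow> (nat \<Rightarrow> nat) set" where
  "indices K d = (\<Pi>\<^sub>E n\<in>{1..K}. {1..d n})"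

definition tensors :: "nat \<Rightarrow> (nat \<Rightarrow> nat) \<Rightarrow> ((nat \<Rightarrow> nat) \<Rightarrow> real) set" where
  "tensors K d = indices K d \<rightarrow>\<^sub>E UNIV"

definition frobenius_norm :: "nat \<Rightarrow> (nat \<Rightarrow> nat) \<Rightarrow> ((nat \<Rightarrow> nat) \<Rightarrow> real) \<Rightarrow> real" where
  "frobenius_norm K d X = L2_set X (indices K d)"

text \<open>The mode sizes \<open>J 1, J 1, J 2, J 2, \<dots>, J N, J N\<close> and the multi-index
  \<open>(j 1, i 1, j 2, i 2, \<dots>, j N, i N)\<close>.\<close>

definition paired_dims :: "(nat \<Rightarrow> nat) \<Rightarrow> nat \<Rightarrow> nat" where
  "paired_dims J k = J ((k + 1) div 2)"

definition interleave :: "nat \<Rightarrow> (nat \<Rightarrow> nat) \<Rightarrow> (nat \<Rightarrow> nat) \<Rightarrow> (nat \<Rightarrow> nat)" where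
  "interleave N j i = (\<lambda>k\<in>{1..2 * N}. if odd k then j ((k + 1) div 2) else i (k div 2))"

definition einstein_product ::
  "nat \<Rightarrow> (nat \<Rightarrow> nat) \<Rightarrow> ((nat \<Rightarrow> nat) \<Rightarrow> real) \<Rightarrow> ((nat \<Rightarrow> nat) \<Rightarrow> real) \<Rightarrow> ((nat \<Rightarrow> nat) \<Rightarrow> real)" where
  "einstein_product N J A X =
     (\<lambda>j\<in>indices N J. \<Sum>i\<in>indices N J. A (interleave N j i) * X i)"

definition mlti_trajectory ::
  "nat \<Rightarrow> (nat \<Rightarrow> nat) \<Rightarrow> ((nat \<Rightarrow> nat) \<Rightarrow> real) \<Rightarrow> (nat \<Rightarrow> (nat \<Rightarrow> nat) \<Rightarrow> real) \<Rightarrow> bool" where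
  "mlti_trajectory N J A X \<longleftrightarrow>
     (\<forall>t. X t \<in> tensors N J) \<and> (\<forall>t. X (Suc t) = einstein_product N J A (X t))"

text \<open>Asymptotic stability of the zero equilibrium; the initial tensor \<open>X 0\<close> is arbitrary.\<close>

definition zero_asymptotically_stable ::
  "nat \<Rightarrow> (nat \<Rightarrow> nat) \<Rightarrow> ((nat \<Rightarrow> nat) \<Rightarrow> real) \<Rightarrow> bool" where
  "zero_asymptotically_stable N J A \<longleftrightarrow>
     (\<forall>X. mlti_trajectory N J A X \<longrightarrow> (\<lambda>t. frobenius_norm N J (X t)) \<longlonglongrightarrow> 0)"

definition outer_product ::
  "nat \<Rightarrow> (nat \<Rightarrow> nat) \<Rightarrow> (nat \<Rightarrow> nat \<Rightarrow> real) \<Rightarrow> ((nat \<Rightarrow> nat) \<Rightarrow> real)" where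
  "outer_product K d v = (\<lambda>k\<in>indices K d. \<Prod>n=1..K. v n (k n))"

text \<open>\<open>a n r\<close> is the \<open>r\<close>-th vector of mode \<open>n\<close>, and \<open>w r\<close> the \<open>r\<close>-th weight.\<close>

definition cp_expansion ::
  "nat \<Rightarrow> (nat \<Rightarrow> nat) \<Rightarrow> ((nat \<Rightarrow> nat) \<Rightarrow> real) \<Rightarrow> nat \<Rightarrow> (nat \<Rightarrow> real) \<Rightarrow>
   (nat \<Rightarrow> nat \<Rightarrow> nat \<Rightarrow> real) \<Rightarrow> bool" where
  "cp_expansion K d A R w a \<longleftrightarrow>
     (\<forall>n\<in>{1..K}. \<forall>r\<in>{1..R}. a n r \<in> {1..d n} \<rightarrow>\<^sub>E UNIV \<and> L2_set (a n r) {1..d n} = 1) \<and>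
     antimono_on {1..R} w \<and> (\<forall>r\<in>{1..R}. 0 < w r) \<and>
     A = (\<lambda>k\<in>indices K d. \<Sum>r=1..R. w r * outer_product K d (\<lambda>n. a n r) k)"

definition cp_rank :: "nat \<Rightarrow> (nat \<Rightarrow> nat) \<Rightarrow> ((nat \<Rightarrow> nat) \<Rightarrow> real) \<Rightarrow> nat" where
  "cp_rank K d A = (LEAST R. \<exists>w a. cp_expansion K d A R w a)"

definition CPD ::
  "nat \<Rightarrow> (nat \<Rightarrow> nat) \<Rightarrow> ((nat \<Rightarrow> nat) \<Rightarrow> real) \<Rightarrow> nat \<Rightarrow> (nat \<Rightarrow> real) \<Rightarrow>
   (nat \<Rightarrow> nat \<Rightarrow> nat \<Rightarrow> real) \<Rightarrow> bool" where
  "CPD K d A R w a \<longleftrightarrow> cp_expansion K d A R w a \<and> R = cp_rank K d A"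

text \<open>Matrices are functions of row and column index; \<open>a n r\<close> is the \<open>r\<close>-th column.\<close>

definition factor_matrix :: "(nat \<Rightarrow> nat \<Rightarrow> nat \<Rightarrow> real) \<Rightarrow> nat \<Rightarrow> (nat \<Rightarrow> nat \<Rightarrow> real)" where
  "factor_matrix a n = (\<lambda>i r. a n r i)"

definition orthonormal_columns :: "nat \<Rightarrow> nat \<Rightarrow> (nat \<Rightarrow> nat \<Rightarrow> real) \<Rightarrow> bool" where
  "orthonormal_columns p q M \<longleftrightarrow>
     (\<forall>r\<in>{1..q}. \<forall>s\<in>{1..q}. (\<Sum>i=1..p. M i r * M i s) = (if r = s then 1 else 0))"

end

theory Submission
  imports Defs
begin

text \<open>Splitting each rank-one term into its odd and its even modes gives
  \<open>A * X = \<Sum>r. w r \<langle>V r, X\<rangle> U r\<close>. The inner product of two outer products is the product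
  of the inner products of the factors, so one orthonormal odd (even) mode makes the whole
  family \<open>U\<close> (\<open>V\<close>) orthonormal. Pythagoras for \<open>U\<close> and Bessel for \<open>V\<close> then give
  \<open>\<parallel>A * X\<parallel> \<le> w 1 \<parallel>X\<parallel>\<close>.\<close>

text \<open>The index set \<open>S\<close> is left arbitrary so that one notion serves for the
  columns of a factor matrix, on \<open>{1..d p}\<close>, and for rank-one tensors, on
  \<open>indices K d\<close>.\<close>

definition orthonormal_family :: "'a set \<Rightarrow> 'b set \<Rightarrow> ('b \<Rightarrow> 'a \<Rightarrow> real) \<Rightarrow> bool" where
  "orthonormal_family S Q U \<longleftrightarrow>
     (\<forall>r\<in>Q. \<forall>s\<in>Q. (\<Sum>x\<in>S. U r x * U s x) = (if r = s then 1 else 0))"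

text \<open>Expanding the square and summing over \<open>S\<close> first leaves the Gram matrix of
  \<open>U\<close>, which is the identity.\<close>

lemma pythagoras_orthonormal_family:
  fixes c :: "'b \<Rightarrow> real"
  assumes "finite Q" and "orthonormal_family S Q U"
  shows "(\<Sum>x\<in>S. (\<Sum>r\<in>Q. c r * U r x)\<^sup>2) = (\<Sum>r\<in>Q. (c r)\<^sup>2)"
proof -
  have "(\<Sum>x\<in>S. (\<Sum>r\<in>Q. c r * U r x)\<^sup>2)
      = (\<Sum>x\<in>S. \<Sum>r\<in>Q. \<Sum>s\<in>Q. c r * c s * (U r x * U s x))"
    by (simp add: power2_eq_square sum_product mult_ac)
  also have "\<dots> = (\<Sum>r\<in>Q. \<Sum>x\<in>S. \<Sum>s\<in>Q. c r * c s * (U r x * U s x))"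
    by (rule sum.swap)
  also have "\<dots> = (\<Sum>r\<in>Q. \<Sum>s\<in>Q. c r * c s * (\<Sum>x\<in>S. U r x * U s x))"
    unfolding sum_distrib_left by (intro sum.cong refl sum.swap)
  also have "\<dots> = (\<Sum>r\<in>Q. \<Sum>s\<in>Q. if r = s then c r * c s else 0)"
    using assms(2) by (intro sum.cong refl) (auto simp: orthonormal_family_def)
  also have "\<dots> = (\<Sum>r\<in>Q. (c r)\<^sup>2)"
    using assms(1) by (simp add: power2_eq_square)
  finally show ?thesis .
qed

text \<open>The squared distance from \<open>X\<close> to its projection onto the span of
  \<open>V\<close> is nonnegative. Both the inner product of \<open>X\<close> with the projection
  and the squared norm of the projection equal the sum of the squared coefficients, so this distance
  is the right side minus the left.\<close>

lemma bessel_orthonormal_family: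
  fixes X :: "'a \<Rightarrow> real"
  assumes "finite Q" and "orthonormal_family S Q V"
  shows "(\<Sum>r\<in>Q. (\<Sum>x\<in>S. V r x * X x)\<^sup>2) \<le> (\<Sum>x\<in>S. (X x)\<^sup>2)"
proof -
  define c where "c r = (\<Sum>x\<in>S. V r x * X x)" for r
  have cross: "(\<Sum>x\<in>S. X x * (\<Sum>r\<in>Q. c r * V r x)) = (\<Sum>r\<in>Q. (c r)\<^sup>2)"
    unfolding sum_distrib_left
    by (subst sum.swap) (simp add: c_def power2_eq_square sum_distrib_left mult_ac)
  have "0 \<le> (\<Sum>x\<in>S. (X x - (\<Sum>r\<in>Q. c r * V r x))\<^sup>2)"
    by (simp add: sum_nonneg)
  also have "\<dots> = (\<Sum>x\<in>S. (X x)\<^sup>2) + (\<Sum>x\<in>S. (\<Sum>r\<in>Q. c r * V r x)\<^sup>2)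
      - 2 * (\<Sum>x\<in>S. X x * (\<Sum>r\<in>Q. c r * V r x))"
    by (simp add: power2_diff sum_subtractf sum.distrib sum_distrib_left mult.assoc)
  also have "\<dots> = (\<Sum>x\<in>S. (X x)\<^sup>2) - (\<Sum>r\<in>Q. (c r)\<^sup>2)"
    using pythagoras_orthonormal_family[OF assms] cross by simp
  finally show ?thesis by (simp add: c_def)
qed

text \<open>The map is given in the form of a singular value decomposition, with \<open>w\<close> up
  to sign the singular values; hence the largest \<open>\<bar>w r\<bar>\<close> bounds its operator
  norm.\<close>

lemma L2_set_orthonormal_combination_le:
  fixes X :: "'b \<Rightarrow> real"
  assumes "finite Q" and "orthonormal_family S Q U" and "orthonormal_family T Q V"
    and "\<And>r. r \<in> Q \<Longrightarrow> \<bar>w r\<bar> \<le> c" and "0 \<le> c"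
  shows "L2_set (\<lambda>x. \<Sum>r\<in>Q. w r * (\<Sum>y\<in>T. V r y * X y) * U r x) S \<le> c * L2_set X T"
proof -
  have "(\<Sum>x\<in>S. (\<Sum>r\<in>Q. w r * (\<Sum>y\<in>T. V r y * X y) * U r x)\<^sup>2)
      = (\<Sum>r\<in>Q. (w r)\<^sup>2 * (\<Sum>y\<in>T. V r y * X y)\<^sup>2)"
    using pythagoras_orthonormal_family[OF assms(1,2)] by (simp add: power_mult_distrib)
  also have "\<dots> \<le> (\<Sum>r\<in>Q. c\<^sup>2 * (\<Sum>y\<in>T. V r y * X y)\<^sup>2)"
    using assms(4,5) by (intro sum_mono mult_right_mono) (auto simp: abs_le_square_iff[symmetric])
  also have "\<dots> \<le> c\<^sup>2 * (\<Sum>y\<in>T. (X y)\<^sup>2)"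
    unfolding sum_distrib_left[symmetric]
    by (intro mult_left_mono bessel_orthonormal_family[OF assms(1,3)]) simp
  finally show ?thesis
    unfolding L2_set_def using assms(5) real_sqrt_le_mono by (fastforce simp: real_sqrt_mult)
qed

lemma sum_indices_prod:
  "(\<Sum>k\<in>indices K d. \<Prod>n=1..K. f n (k n)) = (\<Prod>n=1..K. \<Sum>x=1..d n. f n x :: real)"
  unfolding indices_def by (simp add: prod_sum_PiE)

text \<open>The inner product factors over the modes. For \<open>r = s\<close> every factor is 1 by
  unit length; for \<open>r \<noteq> s\<close> the factor of mode \<open>p\<close> is 0 and
  annihilates the product.\<close>

lemma orthonormal_family_prod:
  assumes unit: "\<And>n r. n \<in> {1..K} \<Longrightarrow> r \<in> Q \<Longrightarrow> L2_set (v n r) {1..d n} = 1"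
    and p: "p \<in> {1..K}" "orthonormal_family {1..d p} Q (v p)"
  shows "orthonormal_family (indices K d) Q (\<lambda>r k. \<Prod>n=1..K. v n r (k n))"
  unfolding orthonormal_family_def
proof (intro ballI)
  fix r s assume rs: "r \<in> Q" "s \<in> Q"
  have eq: "(\<Sum>k\<in>indices K d. (\<Prod>n=1..K. v n r (k n)) * (\<Prod>n=1..K. v n s (k n)))
      = (\<Prod>n=1..K. \<Sum>x=1..d n. v n r x * v n s x)"
    unfolding prod.distrib[symmetric] by (rule sum_indices_prod)
  show "(\<Sum>k\<in>indices K d. (\<Prod>n=1..K. v n r (k n)) * (\<Prod>n=1..K. v n s (k n)))
      = (if r = s then 1 else 0)"
  proof (cases "r = s")
    case True
    have "(\<Sum>x=1..d n. v n r x * v n s x) = 1" if "n \<in> {1..K}" for n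
      using unit[OF that rs(1)] True by (simp add: L2_set_def power2_eq_square)
    then show ?thesis unfolding eq using True by simp
  next
    case False
    then have "(\<Sum>x=1..d p. v p r x * v p s x) = 0"
      using p rs by (simp add: orthonormal_family_def)
    then show ?thesis unfolding eq using False p by (auto intro: prod_zero)
  qed
qed

lemma prod_split_odd_even:
  fixes f :: "nat \<Rightarrow> 'a::comm_monoid_mult"
  shows "(\<Prod>k=1..2 * N. f k) = (\<Prod>p=1..N. f (2 * p - 1)) * (\<Prod>p=1..N. f (2 * p))"
  by (induction N) (simp_all add: mult_ac)

text \<open>Outer products and CP expansions are extensional, so their formulas may be evaluated at
  an interleaved index only once it is known to lie in range.\<close>

lemma interleave_in_indices:
  assumes "j \<in> indices N J" and "i \<in> indices N J"
  shows "interleave N j i \<in> indices (2 * N) (paired_dims J)"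
proof -
  have "interleave N j i k \<in> {1..paired_dims J k}" if k: "k \<in> {1..2 * N}" for k
  proof (cases "odd k")
    case True
    then have "(k + 1) div 2 \<in> {1..N}" using k by (auto elim!: oddE)
    then show ?thesis using assms(1) True k
      by (auto simp: interleave_def paired_dims_def indices_def PiE_iff)
  next
    case False
    \<comment> \<open>For even \<open>k\<close> the quotient that selects the mode size and the one
      that selects the entry of \<open>i\<close> coincide.\<close>
    then have "k div 2 \<in> {1..N}" "(k + 1) div 2 = k div 2" using k by (auto elim!: evenE)
    then show ?thesis using assms(2) False k
      by (auto simp: interleave_def paired_dims_def indices_def PiE_iff)
  qed
  then show ?thesis unfolding indices_def by (auto simp: PiE_iff interleave_def)
qed

text \<open>Odd positions of the interleaved index read \<open>j\<close> and even positions read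
  \<open>i\<close>, so the two groups of variables separate.\<close>

lemma outer_product_interleave:
  assumes "j \<in> indices N J" and "i \<in> indices N J"
  shows "outer_product (2 * N) (paired_dims J) v (interleave N j i)
    = (\<Prod>p=1..N. v (2 * p - 1) (j p)) * (\<Prod>p=1..N. v (2 * p) (i p))"
proof -
  have "(\<Prod>p=1..N. v (2 * p - 1) (interleave N j i (2 * p - 1))) = (\<Prod>p=1..N. v (2 * p - 1) (j p))"
    by (intro prod.cong refl) (auto simp: interleave_def)
  moreover have "(\<Prod>p=1..N. v (2 * p) (interleave N j i (2 * p))) = (\<Prod>p=1..N. v (2 * p) (i p))"
    by (intro prod.cong refl) (auto simp: interleave_def)
  ultimately show ?thesis
    using interleave_in_indices[OF assms]
    unfolding outer_product_def by (simp only: restrict_apply if_True prod_split_odd_even)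
qed

text \<open>Each rank-one term contracts \<open>X\<close> with its even modes and multiplies the
  resulting scalar by the outer product of its odd modes; the two sums are then exchanged.\<close>

lemma einstein_product_cp_expansion:
  assumes "cp_expansion (2 * N) (paired_dims J) A R w a" and j: "j \<in> indices N J"
  shows "einstein_product N J A X j
    = (\<Sum>r=1..R. w r * (\<Sum>i\<in>indices N J. (\<Prod>p=1..N. a (2 * p) r (i p)) * X i)
        * (\<Prod>p=1..N. a (2 * p - 1) r (j p)))"
proof -
  have "A (interleave N j i) = (\<Sum>r=1..R. w r *
      ((\<Prod>p=1..N. a (2 * p - 1) r (j p)) * (\<Prod>p=1..N. a (2 * p) r (i p))))"
    if "i \<in> indices N J" for i
    using assms that interleave_in_indices[OF j that]
    by (simp add: cp_expansion_def outer_product_interleave)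
  then have "einstein_product N J A X j = (\<Sum>i\<in>indices N J. \<Sum>r=1..R. w r *
      ((\<Prod>p=1..N. a (2 * p - 1) r (j p)) * (\<Prod>p=1..N. a (2 * p) r (i p))) * X i)"
    using j by (simp add: einstein_product_def sum_distrib_right)
  also have "\<dots> = (\<Sum>r=1..R. \<Sum>i\<in>indices N J. w r *
      ((\<Prod>p=1..N. a (2 * p - 1) r (j p)) * (\<Prod>p=1..N. a (2 * p) r (i p))) * X i)"
    by (rule sum.swap)
  finally show ?thesis
    by (simp add: sum_distrib_left sum_distrib_right mult_ac)
qed

text \<open>The bound \<open>c\<close> is any nonnegative common bound of the weights, which also
  makes sense for an empty expansion.\<close>

lemma frobenius_norm_einstein_product_le:
  assumes cp: "cp_expansion (2 * N) (paired_dims J) A R w a"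
    and n: "n \<in> {1..2 * N}" "odd n" "orthonormal_columns (paired_dims J n) R (factor_matrix a n)"
    and m: "m \<in> {1..2 * N}" "even m" "orthonormal_columns (paired_dims J m) R (factor_matrix a m)"
    and c: "\<And>r. r \<in> {1..R} \<Longrightarrow> w r \<le> c" "0 \<le> c"
  shows "frobenius_norm N J (einstein_product N J A X) \<le> c * frobenius_norm N J X"
proof -
  define U where "U r j = (\<Prod>p=1..N. a (2 * p - 1) r (j p))" for r j
  define V where "V r i = (\<Prod>p=1..N. a (2 * p) r (i p))" for r i
  have unit: "L2_set (a k r) {1..paired_dims J k} = 1" if "k \<in> {1..2 * N}" "r \<in> {1..R}" for k r
    using cp that by (simp add: cp_expansion_def)
  have odd_dim: "paired_dims J (2 * p - 1) = J p" if "p \<in> {1..N}" for p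
    using that by (auto simp: paired_dims_def)
  have even_dim: "paired_dims J (2 * p) = J p" for p
    by (simp add: paired_dims_def)
  \<comment> \<open>The orthonormal odd mode \<open>n\<close> becomes mode \<open>p\<close> of
    \<open>U\<close>, and the orthonormal even mode \<open>m\<close> becomes mode \<open>q\<close>
    of \<open>V\<close>.\<close>
  obtain p where p: "n = 2 * p - 1" "p \<in> {1..N}"
    using n(1,2) by (auto elim!: oddE intro!: that[of "Suc (n div 2)"])
  obtain q where q: "m = 2 * q" "q \<in> {1..N}"
    using m(1,2) by (auto elim!: evenE)
  have U: "orthonormal_family (indices N J) {1..R} U"
    unfolding U_def
  proof (rule orthonormal_family_prod[where p = p])
    show "L2_set (a (2 * k - 1) r) {1..J k} = 1" if "k \<in> {1..N}" "r \<in> {1..R}" for k r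
      using unit[of "2 * k - 1" r] that odd_dim[of k] by fastforce
    show "orthonormal_family {1..J p} {1..R} (a (2 * p - 1))"
      using n(3) p odd_dim[of p]
      by (simp add: orthonormal_family_def orthonormal_columns_def factor_matrix_def)
  qed (rule p)
  have V: "orthonormal_family (indices N J) {1..R} V"
    unfolding V_def
  proof (rule orthonormal_family_prod[where p = q])
    show "L2_set (a (2 * k) r) {1..J k} = 1" if "k \<in> {1..N}" "r \<in> {1..R}" for k r
      using unit[of "2 * k" r] that by (auto simp: even_dim)
    show "orthonormal_family {1..J q} {1..R} (a (2 * q))"
      using m(3) q even_dim[of q]
      by (simp add: orthonormal_family_def orthonormal_columns_def factor_matrix_def)
  qed (rule q)
  have "frobenius_norm N J (einstein_product N J A X)
      = L2_set (\<lambda>j. \<Sum>r=1..R. w r * (\<Sum>i\<in>indices N J. V r i * X i) * U r j) (indices N J)"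
    unfolding frobenius_norm_def U_def V_def
    by (intro L2_set_cong refl einstein_product_cp_expansion[OF cp])
  also have "\<dots> \<le> c * L2_set X (indices N J)"
  proof (rule L2_set_orthonormal_combination_le[OF _ U V])
    show "\<bar>w r\<bar> \<le> c" if "r \<in> {1..R}" for r
    proof -
      have "0 < w r" using cp that by (simp add: cp_expansion_def)
      then show ?thesis using c(1)[OF that] by simp
    qed
  qed (use c in auto)
  finally show ?thesis by (simp add: frobenius_norm_def)
qed

theorem corollary5p3:
  fixes N R :: nat and J :: "nat \<Rightarrow> nat"
    and A :: "(nat \<Rightarrow> nat) \<Rightarrow> real"
    and w :: "nat \<Rightarrow> real"
    and a :: "nat \<Rightarrow> nat \<Rightarrow> nat \<Rightarrow> real"
  assumes "A \<in> tensors (2 * N) (paired_dims J)"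
    and "CPD (2 * N) (paired_dims J) A R w a"
    and "\<exists>n\<in>{1..2 * N}. odd n \<and> orthonormal_columns (paired_dims J n) R (factor_matrix a n)"
    and "\<exists>m\<in>{1..2 * N}. even m \<and> orthonormal_columns (paired_dims J m) R (factor_matrix a m)"
    and "w 1 < 1"
  shows "zero_asymptotically_stable N J A"
  unfolding zero_asymptotically_stable_def
proof (intro allI impI)
  fix X assume X: "mlti_trajectory N J A X"
  have cp: "cp_expansion (2 * N) (paired_dims J) A R w a"
    using assms(2) unfolding CPD_def by blast
  \<comment> \<open>If \<open>R = 0\<close> then \<open>w 1\<close> is a junk value and may be negative.\<close>
  define c where "c = max 0 (w 1)"
  have c: "0 \<le> c" "c < 1" using assms(5) by (auto simp: c_def)
  have wc: "w r \<le> c" if "r \<in> {1..R}" for r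
  proof -
    have "antimono_on {1..R} w" using cp by (simp add: cp_expansion_def)
    \<comment> \<open>An \<open>r\<close> in \<open>{1..R}\<close> forces \<open>1 \<le> R\<close>,
      so index 1 is in the range where \<open>w\<close> is antitone.\<close>
    then have "w r \<le> w 1" using that by (auto simp: monotone_on_def)
    then show ?thesis by (simp add: c_def)
  qed
  obtain n where n: "n \<in> {1..2 * N}" "odd n"
      "orthonormal_columns (paired_dims J n) R (factor_matrix a n)"
    using assms(3) by blast
  obtain m where m: "m \<in> {1..2 * N}" "even m"
      "orthonormal_columns (paired_dims J m) R (factor_matrix a m)"
    using assms(4) by blast
  have step: "frobenius_norm N J (X (Suc t)) \<le> c * frobenius_norm N J (X t)" for t
    using X frobenius_norm_einstein_product_le[OF cp n m wc c(1)]
    by (simp add: mlti_trajectory_def)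
  have bound: "frobenius_norm N J (X t) \<le> c ^ t * frobenius_norm N J (X 0)" for t
  proof (induction t)
    case (Suc t)
    then show ?case
      using order_trans[OF step mult_left_mono[OF Suc c(1)]] by (simp add: mult.assoc)
  qed simp
  have "(\<lambda>t. c ^ t * frobenius_norm N J (X 0)) \<longlonglongrightarrow> 0"
    using c by (intro tendsto_mult_left_zero LIMSEQ_power_zero) simp
  then show "(\<lambda>t. frobenius_norm N J (X t)) \<longlonglongrightarrow> 0"
    \<comment> \<open>The lower bound is the constant 0, the upper one the geometric majorant;
      \<open>rotated 2\<close> puts the limit of the majorant first, to be met by the chained
      fact.\<close>
    by (rule real_tendsto_sandwich[OF _ _ tendsto_const, rotated 2])
      (use bound in \<open>simp_all add: frobenius_norm_def L2_set_nonneg\<close>)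
qed

end
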